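(* If $T$ is a tree, then $\gamma_{\rm sp}(T) = n(T) - \alpha'(T)$. Moreover, a super dominating set of $T$ of cardinality $\gamma_{\rm sp}(T)$ can be determined in linear time over the class of trees; that is, there is an algorithm which, given any tree $T$, outputs such a set in time linear in the size of $T$.
   Context: All graphs are finite, simple and undirected. $n(G)$ denotes the number of vertices of $G$ and $\alpha'(G)$ its matching number (the maximum size of a matching). For $D\subseteq V(G)$ write $\overline{D}=V(G)\setminus D$, and let $N_G(v)$ be the open neighborhood of $v$. A set $D\subseteq V(G)$ is a dominating set if every vertex of $\overline{D}$ has a neighbor in $D$. A dominating set $D$ is a super dominating set if for every $x\in\overline{D}$ there exists $y\in D$ such that $N_G(y)\cap\overline{D}=\{x\}$. The super domination number $\gamma_{\rm sp}(G)$ is the minimum cardinality of a super dominating set of $G$. *)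

theory Defs
  imports Main
begin

section \<open>Finite simple graphs and trees\<close>

text \<open>A graph is given by its vertex set and its set of edges; an edge is a two-element set.\<close>

definition simple_graph :: "'a set \<Rightarrow> 'a set set \<Rightarrow> bool" where
  "simple_graph V E \<longleftrightarrow> finite V \<and> (\<forall>e\<in>E. e \<subseteq> V \<and> card e = 2)"

definition nbh :: "'a set set \<Rightarrow> 'a \<Rightarrow> 'a set" where
  "nbh E v = {u. {v, u} \<in> E}"

definition connected_graph :: "'a set \<Rightarrow> 'a set set \<Rightarrow> bool" where
  "connected_graph V E \<longleftrightarrow>
     V \<noteq> {} \<and> (\<forall>u\<in>V. \<forall>v\<in>V. (u, v) \<in> {(x, y). {x, y} \<in> E}\<^sup>*)"

definition graph_cycle :: "'a set set \<Rightarrow> 'a list \<Rightarrow> bool" where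
  "graph_cycle E xs \<longleftrightarrow>
     length xs \<ge> 3 \<and> distinct xs \<and>
     (\<forall>i. Suc i < length xs \<longrightarrow> {xs ! i, xs ! Suc i} \<in> E) \<and> {last xs, hd xs} \<in> E"

definition tree :: "'a set \<Rightarrow> 'a set set \<Rightarrow> bool" where
  "tree V E \<longleftrightarrow> simple_graph V E \<and> connected_graph V E \<and> (\<nexists>xs. graph_cycle E xs)"


section \<open>Matchings and super dominating sets\<close>

definition matching :: "'a set set \<Rightarrow> 'a set set \<Rightarrow> bool" where
  "matching E M \<longleftrightarrow> M \<subseteq> E \<and> pairwise disjnt M"

definition matching_number :: "'a set set \<Rightarrow> nat" where
  "matching_number E = Max {card M | M. matching E M}"

definition dominating :: "'a set \<Rightarrow> 'a set set \<Rightarrow> 'a set \<Rightarrow> bool" where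
  "dominating V E D \<longleftrightarrow> D \<subseteq> V \<and> (\<forall>v \<in> V - D. nbh E v \<inter> D \<noteq> {})"

definition super_dominating :: "'a set \<Rightarrow> 'a set set \<Rightarrow> 'a set \<Rightarrow> bool" where
  "super_dominating V E D \<longleftrightarrow>
     dominating V E D \<and> (\<forall>x \<in> V - D. \<exists>y\<in>D. nbh E y \<inter> (V - D) = {x})"

definition super_domination_number :: "'a set \<Rightarrow> 'a set set \<Rightarrow> nat" where
  "super_domination_number V E = Min {card D | D. super_dominating V E D}"


section \<open>A random access machine\<close>

text \<open>
  The model of computation is a random access machine with structured control flow. Its memory
  consists of registers and arrays that hold natural numbers. A program is a finite piece of
  syntax and so mentions only finitely many registers, arrays and constants; array cells are
  addressed indirectly through registers. Every instruction and every evaluation of a test takes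
  one unit of time.

  The only arithmetic is increment and decrement (truncated at 0). Hence a number that occurs in
  a run exceeds the largest number of the program and the input by at most the running time, so
  in a run that is linear in the number of vertices of the input graph all numbers have
  logarithmically many bits, and the unit cost measure does not hide any work on large numbers.
\<close>

type_synonym reg = nat
type_synonym arr = nat

datatype test =
    Equal reg reg
  | Less reg reg

datatype program =
    Skip
  | Const reg nat       \<comment> \<open>\<open>r := k\<close>\<close>
  | Copy reg reg        \<comment> \<open>\<open>r := q\<close>\<close>
  | Inc reg
  | Dec reg
  | Load reg arr reg    \<comment> \<open>\<open>r := a[q]\<close>\<close>
  | Store arr reg reg   \<comment> \<open>\<open>a[r] := q\<close>\<close>
  | Seq program program
  | Branch test program program
  | Loop test program

record memory =
  regs :: "reg \<Rightarrow> nat"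
  arrs :: "arr \<Rightarrow> nat \<Rightarrow> nat"

fun holds :: "test \<Rightarrow> memory \<Rightarrow> bool" where
  "holds (Equal r q) s \<longleftrightarrow> regs s r = regs s q"
| "holds (Less r q) s \<longleftrightarrow> regs s r < regs s q"

definition set_reg :: "reg \<Rightarrow> nat \<Rightarrow> memory \<Rightarrow> memory" where
  "set_reg r k s = s\<lparr>regs := (regs s)(r := k)\<rparr>"

definition set_cell :: "arr \<Rightarrow> nat \<Rightarrow> nat \<Rightarrow> memory \<Rightarrow> memory" where
  "set_cell a i k s = s\<lparr>arrs := (arrs s)(a := (arrs s a)(i := k))\<rparr>"

text \<open>\<open>exec p s t s'\<close>: started in memory \<open>s\<close>, program \<open>p\<close> halts after \<open>t\<close> units of time
  in memory \<open>s'\<close>.\<close>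

inductive exec :: "program \<Rightarrow> memory \<Rightarrow> nat \<Rightarrow> memory \<Rightarrow> bool" where
  Skip: "exec Skip s 1 s"
| Const: "exec (Const r k) s 1 (set_reg r k s)"
| Copy: "exec (Copy r q) s 1 (set_reg r (regs s q) s)"
| Inc: "exec (Inc r) s 1 (set_reg r (regs s r + 1) s)"
| Dec: "exec (Dec r) s 1 (set_reg r (regs s r - 1) s)"
| Load: "exec (Load r a q) s 1 (set_reg r (arrs s a (regs s q)) s)"
| Store: "exec (Store a r q) s 1 (set_cell a (regs s r) (regs s q) s)"
| Seq: "exec p s t s' \<Longrightarrow> exec p' s' t' s'' \<Longrightarrow> exec (Seq p p') s (t + t') s''"
| Branch_True: "holds b s \<Longrightarrow> exec p s t s' \<Longrightarrow> exec (Branch b p p') s (1 + t) s'"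
| Branch_False: "\<not> holds b s \<Longrightarrow> exec p' s t s' \<Longrightarrow> exec (Branch b p p') s (1 + t) s'"
| Loop_False: "\<not> holds b s \<Longrightarrow> exec (Loop b p) s 1 s"
| Loop_True: "holds b s \<Longrightarrow> exec p s t s' \<Longrightarrow> exec (Loop b p) s' t' s'' \<Longrightarrow>
    exec (Loop b p) s (1 + t + t') s''"

lemma exec_deterministic:
  assumes "exec p s t s'" and "exec p s u s''"
  shows "t = u \<and> s' = s''"
  using assms
proof (induction arbitrary: u s'' rule: exec.induct)
  case (Seq p s t s' p' t' s3)
  from Seq.prems show ?case by cases (use Seq.IH in blast)
next
  case (Branch_True b s p t s' p')
  from Branch_True.prems show ?case
    by cases (use Branch_True.hyps Branch_True.IH in blast)+
next
  case (Branch_False b s p' t s' p)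
  from Branch_False.prems show ?case
    by cases (use Branch_False.hyps Branch_False.IH in blast)+
next
  case (Loop_False b s p)
  from Loop_False.prems show ?case by cases (use Loop_False.hyps in auto)
next
  case (Loop_True b s p t s' t' s3)
  from Loop_True.prems show ?case
    by cases (use Loop_True.hyps Loop_True.IH in blast)+
qed (auto elim: exec.cases)


section \<open>Graphs as input, vertex sets as output\<close>

text \<open>The vertices of an input graph are numbered from 0, and \<open>adj ! v\<close> lists the neighbors
  of \<open>v\<close> in some order.\<close>

definition adjacency_lists :: "nat set \<Rightarrow> nat set set \<Rightarrow> nat list list \<Rightarrow> bool" where
  "adjacency_lists V E adj \<longleftrightarrow>
     V = {..<length adj} \<and> (\<forall>v\<in>V. distinct (adj ! v) \<and> set (adj ! v) = nbh E v)"

text \<open>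
  Register 0 holds the number \<open>n\<close> of vertices. Array 1 holds the adjacency lists one after the
  other, and the list of \<open>v\<close> occupies the cells from (array 0)\<open>[v]\<close> up to but excluding
  (array 0)\<open>[v + 1]\<close>. All other memory is 0.
\<close>

definition input_memory :: "nat list list \<Rightarrow> memory" where
  "input_memory adj =
    \<lparr>regs = (\<lambda>r. if r = 0 then length adj else 0),
     arrs = (\<lambda>a i.
       if a = 0 \<and> i \<le> length adj then length (concat (take i adj))
       else if a = 1 \<and> i < length (concat adj) then concat adj ! i
       else 0)\<rparr>"

text \<open>The output is a set of vertices, given by its characteristic vector in array 2.\<close>

definition output_set :: "nat set \<Rightarrow> memory \<Rightarrow> nat set" where
  "output_set V s = {v \<in> V. arrs s 2 v \<noteq> 0}"

end

theory Submission
  imports Defs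
begin

text \<open>If \<open>D\<close> is super dominating, the vertices outside \<open>D\<close> together with their private neighbors
  form a matching, so \<open>n - card D\<close> is at most the matching number. Conversely, let \<open>M\<close> be a maximum
  matching of a tree. Since there are no cycles, the vertices can be labelled with two colors such
  that exactly the edges of \<open>M\<close> have ends of different colors: start at a root and go down.
  The matched vertices of one color form the complement of a super dominating set, because a
  neighbor of the other color must be the partner.

  A maximum matching is found greedily, by matching each vertex to its parent if both are
  still free, in the reverse of a breadth-first order. The vertices that are matched to a child then
  form a vertex cover of the same size. So a search, a pass backwards for the matching and
  a pass forwards for the labels suffice.\<close>

section \<open>Super dominating sets and matchings\<close>

lemma nbh_sym: "u \<in> nbh E v \<longleftrightarrow> v \<in> nbh E u"
  by (simp add: nbh_def insert_commute)

lemma simple_graph_finite_edges: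
  assumes "simple_graph V E" shows "finite E"
proof -
  have "E \<subseteq> Pow V" "finite V" using assms by (auto simp: simple_graph_def)
  then show ?thesis by (meson finite_Pow_iff finite_subset)
qed

lemma simple_graph_edgeD:
  assumes "simple_graph V E" "{u, v} \<in> E"
  shows "u \<in> V" "v \<in> V" "u \<noteq> v"
  using assms by (auto simp: simple_graph_def card_2_iff doubleton_eq_iff)

lemma finite_matching_cards:
  assumes "simple_graph V E" shows "finite {card M | M. matching E M}"
proof -
  have "{M. matching E M} \<subseteq> Pow E" by (auto simp: matching_def)
  then have "finite {M. matching E M}"
    using simple_graph_finite_edges[OF assms] by (meson finite_Pow_iff finite_subset)
  then show ?thesis by simp
qed

lemma card_matching_le:
  assumes "simple_graph V E" "matching E M" shows "card M \<le> matching_number E"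
  unfolding matching_number_def using finite_matching_cards[OF assms(1)] assms(2)
  by (intro Max_ge) auto

lemma maximum_matching:
  assumes "simple_graph V E"
  obtains M where "matching E M" "card M = matching_number E"
proof -
  have "matching E {}" by (simp add: matching_def)
  then have "{card M | M. matching E M} \<noteq> {}" by blast
  from Max_in[OF finite_matching_cards[OF assms] this] that show thesis
    by (auto simp: matching_number_def)
qed

lemma matching_unique:
  assumes "matching E M" "e \<in> M" "f \<in> M" "x \<in> e" "x \<in> f" shows "e = f"
  using assms by (auto simp: matching_def pairwise_def disjnt_def)

text \<open>The chosen private neighbor \<open>y x\<close> determines \<open>x\<close>, since
  \<open>x\<close> is its only neighbor outside \<open>D\<close>. So \<open>y\<close> is injective,
  and as each \<open>e x\<close> has one end on either side of \<open>D\<close>, these edges are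
  pairwise disjoint.\<close>

lemma super_dominating_lower_bound:
  assumes sg: "simple_graph V E" and D: "super_dominating V E D"
  shows "card V \<le> card D + matching_number E"
proof -
  have DV: "D \<subseteq> V" using D by (simp add: super_dominating_def dominating_def)
  have finV: "finite V" using sg by (simp add: simple_graph_def)
  have "\<forall>x\<in>V - D. \<exists>y\<in>D. nbh E y \<inter> (V - D) = {x}"
    using D by (simp add: super_dominating_def)
  then obtain y where y: "\<And>x. x \<in> V - D \<Longrightarrow> y x \<in> D \<and> nbh E (y x) \<inter> (V - D) = {x}"
    by metis
  define e where "e x = {x, y x}" for x
  have e_disj: "disjnt (e x) (e x')" if "x \<in> V - D" "x' \<in> V - D" "x \<noteq> x'" for x x'
  proof -
    have "y x \<noteq> y x'" using y[of x] y[of x'] that by auto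
    then show ?thesis using y[of x] y[of x'] that by (auto simp: e_def disjnt_def)
  qed
  have "e x \<in> E" if "x \<in> V - D" for x
  proof -
    have "x \<in> nbh E (y x)" using y[OF that] by blast
    then show ?thesis by (simp add: nbh_def e_def insert_commute)
  qed
  then have "matching E (e ` (V - D))"
    using e_disj by (auto simp: matching_def pairwise_def)
  moreover have "inj_on e (V - D)"
    using e_disj by (force simp: inj_on_def disjnt_def e_def)
  ultimately have "card (V - D) \<le> matching_number E"
    using card_matching_le[OF sg] by (metis card_image)
  then show ?thesis using DV finV by (simp add: card_Diff_subset finite_subset)
qed

text \<open>For \<open>x\<close> outside \<open>D\<close> the private neighbor is its partner
  \<open>y\<close> in \<open>M\<close>: a further neighbor of \<open>y\<close> outside
  \<open>D\<close> would lie in \<open>X\<close>, so its edge to \<open>y\<close> would also be in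
  \<open>M\<close>. The complement of \<open>D\<close> meets each edge of \<open>M\<close> exactly
  once, which gives the count for any matching \<open>M\<close>. \<open>D\<close> enters through an
  equation so that the output of the machine can be substituted for it.\<close>

lemma super_dominating_of_labelling:
  assumes sg: "simple_graph V E" and M: "matching E M"
    and X: "\<And>u v. {u, v} \<in> E \<Longrightarrow> (u \<in> X) \<noteq> (v \<in> X) \<longleftrightarrow> {u, v} \<in> M"
    and D: "D = V - X \<inter> \<Union>M"
  shows "super_dominating V E D" "card D + card M = card V"
proof -
  have finV: "finite V" using sg by (simp add: simple_graph_def)
  have ME: "M \<subseteq> E" using M by (simp add: matching_def)
  then have MV: "\<Union>M \<subseteq> V" using sg by (auto simp: simple_graph_def)
  then have VD: "V - D = X \<inter> \<Union>M" by (auto simp: D)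
  have edge: "\<exists>x y. e = {x, y} \<and> x \<in> X \<and> y \<notin> X" if "e \<in> M" for e
  proof -
    have "card e = 2" using that ME sg by (auto simp: simple_graph_def)
    then obtain x y where "e = {x, y}" by (auto simp: card_2_iff)
    moreover then have "(x \<in> X) \<noteq> (y \<in> X)" using X that ME by blast
    ultimately show ?thesis by (metis insert_commute)
  qed
  have sd: "\<exists>y\<in>D. nbh E y \<inter> (V - D) = {x}" if "x \<in> V - D" for x
  proof -
    have "x \<in> X" "x \<in> \<Union>M" using that VD by auto
    then obtain e where e: "e \<in> M" "x \<in> e" by blast
    with edge[of e] \<open>x \<in> X\<close> obtain y where y: "e = {x, y}" "y \<notin> X" by force
    have "y \<in> D" using e y MV by (auto simp: D)
    moreover have "z = x" if z: "z \<in> nbh E y" "z \<in> V - D" for z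
    proof -
      have "{y, z} \<in> M" using X[of y z] z y VD by (auto simp: nbh_def)
      then have "{y, z} = {x, y}" using matching_unique[OF M, of "{y, z}" e y] e y by simp
      then show ?thesis using y \<open>x \<in> X\<close> by (auto simp: doubleton_eq_iff)
    qed
    moreover have "x \<in> nbh E y" using e y ME by (auto simp: nbh_def insert_commute)
    ultimately show ?thesis using that by blast
  qed
  have "nbh E x \<inter> D \<noteq> {}" if "x \<in> V - D" for x
    using sd[OF that] nbh_sym[of x E] by blast
  with sd show "super_dominating V E D"
    by (auto simp: super_dominating_def dominating_def D)
  have "card (X \<inter> e) = 1" if e: "e \<in> M" for e
  proof -
    obtain x y where "e = {x, y}" "x \<in> X" "y \<notin> X" using edge[OF e] by blast
    then have "X \<inter> e = {x}" by auto
    then show ?thesis by simp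
  qed
  moreover have "finite M" using ME simple_graph_finite_edges[OF sg] finite_subset by blast
  moreover have "\<forall>e\<in>M. finite (X \<inter> e)" using MV finV by (meson Union_upper finite_Int finite_subset)
  moreover have "\<forall>e\<in>M. \<forall>f\<in>M. e \<noteq> f \<longrightarrow> (X \<inter> e) \<inter> (X \<inter> f) = {}"
    using matching_unique[OF M] by blast
  ultimately have "card (\<Union>e\<in>M. X \<inter> e) = card M"
    using card_UN_disjoint[of M "\<lambda>e. X \<inter> e"] by simp
  moreover have "(\<Union>e\<in>M. X \<inter> e) = V - D" using VD by auto
  moreover have "card (V - D) + card D = card V"
    using finV card_Diff_subset[of D V] card_mono[of V D] by (auto simp: D)
  ultimately show "card D + card M = card V" by (metis add.commute)
qed

lemma super_domination_number_eqI:
  assumes sg: "simple_graph V E" and D: "super_dominating V E D"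
    and card: "card D + matching_number E = card V"
  shows "super_domination_number V E = card D"
  unfolding super_domination_number_def
proof (rule Min_eqI)
  have "{D. super_dominating V E D} \<subseteq> Pow V"
    by (auto simp: super_dominating_def dominating_def)
  moreover have "finite V" using sg by (simp add: simple_graph_def)
  ultimately have "finite {D. super_dominating V E D}" by (meson finite_Pow_iff finite_subset)
  then show "finite {card D | D. super_dominating V E D}" by simp
  show "card D \<le> k" if "k \<in> {card D | D. super_dominating V E D}" for k
    using that super_dominating_lower_bound[OF sg] card by fastforce
qed (use D in auto)

section \<open>Search orders of trees\<close>

text \<open>The list \<open>q 0, ..., q (t - 1)\<close> grows a rooted subtree one vertex at a time;
  it need not be breadth-first. The value of \<open>par\<close> at the root \<open>q 0\<close> is
  arbitrary.\<close>

definition search_order :: "'a set set \<Rightarrow> (nat \<Rightarrow> 'a) \<Rightarrow> ('a \<Rightarrow> 'a) \<Rightarrow> nat \<Rightarrow> bool" where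
  "search_order E q par t \<longleftrightarrow>
     inj_on q {..<t} \<and> (\<forall>i\<in>{0<..<t}. \<exists>j<i. par (q i) = q j \<and> {q j, q i} \<in> E)"

lemma search_order_mono: "search_order E q par t \<Longrightarrow> s \<le> t \<Longrightarrow> search_order E q par s"
  by (auto simp: search_order_def inj_on_def)

lemma search_order_parent:
  assumes "search_order E q par t" "0 < i" "i < t"
  obtains j where "j < i" "par (q i) = q j" "{q j, q i} \<in> E"
  using assms unfolding search_order_def by (meson greaterThanLessThan_iff)

lemma search_order_inj:
  "search_order E q par t \<Longrightarrow> i < t \<Longrightarrow> j < t \<Longrightarrow> q i = q j \<longleftrightarrow> i = j"
  by (auto simp: search_order_def inj_on_def)

lemma search_order_extend:
  assumes so: "search_order E q par t" and j: "j < t" "{q j, u} \<in> E" and u: "u \<notin> q ` {..<t}"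
  shows "search_order E (q(t := u)) (par(u := q j)) (Suc t)"
  unfolding search_order_def
proof (intro conjI ballI)
  show "inj_on (q(t := u)) {..<Suc t}"
    using so u by (fastforce simp: search_order_def inj_on_def less_Suc_eq)
  fix i assume i: "i \<in> {0<..<Suc t}"
  show "\<exists>k<i. (par(u := q j)) ((q(t := u)) i) = (q(t := u)) k
      \<and> {(q(t := u)) k, (q(t := u)) i} \<in> E"
  proof (cases "i = t")
    case True
    then show ?thesis using j by (intro exI[of _ j]) auto
  next
    case False
    then have "0 < i" "i < t" using i by auto
    moreover obtain k where "k < i" "par (q i) = q k" "{q k, q i} \<in> E"
      using search_order_parent[OF so \<open>0 < i\<close> \<open>i < t\<close>] .
    moreover have "q i \<noteq> u" using u \<open>i < t\<close> by auto
    ultimately show ?thesis by (intro exI[of _ k]) auto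
  qed
qed

text \<open>Follow the walk and extend a path; whenever the walk returns to a vertex of the path,
  cut the path back to that vertex. The relation restricts only the targets of steps to
  \<open>S\<close>, hence the separate assumption on \<open>a\<close>.\<close>

lemma simple_path:
  assumes "(a, b) \<in> {(x, y). {x, y} \<in> E \<and> y \<in> S}\<^sup>*" "a \<in> S"
  shows "\<exists>xs. xs \<noteq> [] \<and> hd xs = a \<and> last xs = b \<and> distinct xs \<and> set xs \<subseteq> S \<and>
    successively (\<lambda>x y. {x, y} \<in> E) xs"
  using assms
proof (induction rule: rtrancl_induct)
  case base
  then show ?case by (intro exI[of _ "[a]"]) auto
next
  case (step y z)
  then obtain xs where xs: "xs \<noteq> []" "hd xs = a" "last xs = y" "distinct xs" "set xs \<subseteq> S"
    "successively (\<lambda>x y. {x, y} \<in> E) xs" by blast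
  show ?case
  proof (cases "z \<in> set xs")
    case True
    then obtain ys zs where "xs = ys @ z # zs" by (meson split_list)
    then show ?thesis using xs
      by (intro exI[of _ "ys @ [z]"]) (auto simp: successively_append_iff hd_append)
  next
    case False
    then show ?thesis using xs step
      by (intro exI[of _ "xs @ [z]"]) (auto simp: successively_append_iff)
  qed
qed

text \<open>Parents come strictly earlier, so climbing ends at \<open>q 0\<close>. Both directions
  are carried along because the relation, which restricts only targets, is not symmetric as it
  stands.\<close>

lemma search_order_connected:
  assumes so: "search_order E q par t" and "i < t"
  shows "(q i, q 0) \<in> {(x, y). {x, y} \<in> E \<and> y \<in> q ` {..<t}}\<^sup>* \<and>
    (q 0, q i) \<in> {(x, y). {x, y} \<in> E \<and> y \<in> q ` {..<t}}\<^sup>*"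
  using \<open>i < t\<close>
proof (induction i rule: less_induct)
  case (less i)
  let ?r = "{(x, y). {x, y} \<in> E \<and> y \<in> q ` {..<t}}"
  show ?case
  proof (cases "i = 0")
    case False
    then obtain j where j: "j < i" "{q j, q i} \<in> E"
      using search_order_parent[OF so _ less.prems] by blast
    then have "(q i, q j) \<in> ?r" "(q j, q i) \<in> ?r"
      using less.prems by (auto simp: insert_commute)
    then show ?thesis using less.IH[of j] j less.prems
      by (meson converse_rtrancl_into_rtrancl less_trans rtrancl_into_rtrancl)
  qed simp
qed

text \<open>Two edges from \<open>q b\<close> to earlier vertices would close a cycle through the earlier vertices,
  which are connected.\<close>

lemma search_order_edge:
  assumes acyclic: "\<nexists>xs. graph_cycle E xs" and so: "search_order E q par t"
    and ab: "a < b" "b < t" "{q a, q b} \<in> E"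
  shows "par (q b) = q a"
proof (rule ccontr)
  assume neq: "par (q b) \<noteq> q a"
  obtain p where p: "p < b" "par (q b) = q p" "{q p, q b} \<in> E"
    using search_order_parent[OF so, of b] ab by (metis gr_zeroI not_less_zero)
  have sob: "search_order E q par b" using search_order_mono[OF so] ab by simp
  let ?S = "q ` {..<b}"
  have "(q a, q p) \<in> {(x, y). {x, y} \<in> E \<and> y \<in> ?S}\<^sup>*"
    using search_order_connected[OF sob] ab p by (meson rtrancl_trans)
  then obtain xs where xs: "xs \<noteq> []" "hd xs = q a" "last xs = q p" "distinct xs"
    "set xs \<subseteq> ?S" "successively (\<lambda>x y. {x, y} \<in> E) xs"
    using simple_path[of "q a" "q p" E ?S] ab by blast
  \<comment> \<open>With \<open>q b\<close> appended the list must have at least three vertices to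
    count as a cycle; a path of one vertex would force \<open>q a = q p\<close>, the parent.\<close>
  have "length xs \<ge> 2"
  proof (rule ccontr)
    assume "\<not> ?thesis"
    then have "hd xs = last xs" using xs(1) by (cases xs) (auto simp: not_le)
    then show False using xs neq p by simp
  qed
  moreover have "q b \<notin> ?S" using search_order_inj[OF so] ab by auto
  moreover have "successively (\<lambda>x y. {x, y} \<in> E) (xs @ [q b])"
    using xs p by (simp add: successively_append_iff)
  ultimately have "graph_cycle E (xs @ [q b])"
    using xs ab by (auto simp: graph_cycle_def successively_conv_nth insert_commute)
  then show False using acyclic by blast
qed

text \<open>A walk from the root can never leave a set that contains all neighbors of its
  members.\<close>

lemma search_order_closed:
  assumes conn: "connected_graph V E" and "q ` {..<t} \<subseteq> V" "0 < t"
    and closed: "\<And>i. i < t \<Longrightarrow> nbh E (q i) \<subseteq> q ` {..<t}"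
  shows "q ` {..<t} = V"
proof -
  have "v \<in> q ` {..<t}" if "v \<in> V" for v
  proof -
    have "(q 0, v) \<in> {(x, y). {x, y} \<in> E}\<^sup>*"
      using assms that by (auto simp: connected_graph_def)
    then show ?thesis
      by (induction rule: rtrancl_induct) (use \<open>0 < t\<close> closed in \<open>auto simp: nbh_def\<close>)
  qed
  then show ?thesis using assms by blast
qed

text \<open>Every edge of a tree joins a child to its parent: the end that is listed earlier is the
  parent, by \<open>search_order_edge\<close>. This reduces claims about all edges to claims about
  the pairs \<open>q i\<close>, \<open>par (q i)\<close>.\<close>

lemma search_order_edge_cases:
  assumes tree: "tree V E" and so: "search_order E q par t" and V: "q ` {..<t} = V"
    and e: "{u, v} \<in> E"
  obtains i where "0 < i" "i < t" "u = q i" "v = par u"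
    | i where "0 < i" "i < t" "v = q i" "u = par v"
proof -
  have sg: "simple_graph V E" and ac: "\<nexists>xs. graph_cycle E xs" using tree by (auto simp: tree_def)
  obtain i j where ij: "u = q i" "v = q j" "i < t" "j < t"
    using simple_graph_edgeD[OF sg e] V by blast
  then consider "i < j" | "j < i" using simple_graph_edgeD(3)[OF sg e] by (metis linorder_neqE_nat)
  then show thesis
  proof cases
    case 1
    then show thesis using search_order_edge[OF ac so, of i j] ij e by (intro that(2)[of j]) auto
  next
    case 2
    then show thesis using search_order_edge[OF ac so, of j i] ij e
      by (intro that(1)[of i]) (auto simp: insert_commute)
  qed
qed

text \<open>A search order of greatest length exists, since injectivity bounds the length by
  \<open>card V\<close>. A neighbor outside it would allow an extension, so it is closed under
  neighbors and lists all vertices.\<close>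

lemma tree_search_order:
  assumes tree: "tree V E"
  obtains q par t where "search_order E q par t" "q ` {..<t} = V"
proof -
  have sg: "simple_graph V E" and conn: "connected_graph V E" using tree by (auto simp: tree_def)
  have finV: "finite V" using sg by (simp add: simple_graph_def)
  obtain r where r: "r \<in> V" using conn by (auto simp: connected_graph_def)
  define P where "P t \<longleftrightarrow> 0 < t \<and> (\<exists>q par. search_order E q par t \<and> q ` {..<t} \<subseteq> V)" for t
  have "P 1" using r by (auto simp: P_def search_order_def inj_on_def intro!: exI[of _ "\<lambda>_. r"])
  moreover have "\<forall>t. P t \<longrightarrow> t \<le> card V"
    using finV unfolding P_def by (metis card_image card_lessThan card_mono search_order_def)
  ultimately obtain t where t: "P t" and max: "\<And>s. P s \<Longrightarrow> s \<le> t"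
    using GreatestI_nat[of P 1 "card V"] Greatest_le_nat[of P _ "card V"] by blast
  then obtain q par where q: "search_order E q par t" "q ` {..<t} \<subseteq> V"
    by (auto simp: P_def)
  have "nbh E (q i) \<subseteq> q ` {..<t}" if i: "i < t" for i
  proof
    fix u assume u: "u \<in> nbh E (q i)"
    show "u \<in> q ` {..<t}"
    proof (rule ccontr)
      assume nu: "u \<notin> q ` {..<t}"
      have e: "{q i, u} \<in> E" using u by (simp add: nbh_def)
      have "(q(t := u)) ` {..<Suc t} \<subseteq> V"
        using q simple_graph_edgeD[OF sg e] by (auto simp: less_Suc_eq)
      then have "P (Suc t)" using search_order_extend[OF q(1) i e nu]
        unfolding P_def by blast
      then show False using max[of "Suc t"] by simp
    qed
  qed
  moreover have "0 < t" using t by (simp add: P_def)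
  ultimately show thesis using search_order_closed[OF conn q(2)] that[OF q(1)] by blast
qed

text \<open>Labels can be assigned in list order: \<open>q t\<close> is neither an earlier vertex
  nor the parent of one, so its label can still be chosen freely after all earlier constraints are
  met.\<close>

lemma labelling_exists:
  assumes so: "search_order E q par t"
  shows "\<exists>X. \<forall>i\<in>{0<..<t}. (q i \<in> X) \<noteq> (par (q i) \<in> X) \<longleftrightarrow> {q i, par (q i)} \<in> M"
  using so
proof (induction t)
  case (Suc t)
  have so: "search_order E q par t" using search_order_mono[OF Suc.prems] by simp
  then obtain X where X: "\<And>i. 0 < i \<Longrightarrow> i < t \<Longrightarrow>
      (q i \<in> X) \<noteq> (par (q i) \<in> X) \<longleftrightarrow> {q i, par (q i)} \<in> M"
    using Suc.IH unfolding Ball_def greaterThanLessThan_iff by meson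
  \<comment> \<open>\<open>q t\<close> takes the label of its parent, flipped exactly if the edge
    between them is in \<open>M\<close>.\<close>
  define Y where "Y = (if (par (q t) \<in> X) \<noteq> ({q t, par (q t)} \<in> M)
    then insert (q t) X else X - {q t})"
  have Y: "x \<in> Y \<longleftrightarrow> x \<in> X" if "x \<noteq> q t" for x using that by (auto simp: Y_def)
  have neq: "q i \<noteq> q t" if "i < t" for i using search_order_inj[OF Suc.prems] that by auto
  have par: "par (q i) \<noteq> q t" if "0 < i" "i \<le> t" for i
    using search_order_parent[OF Suc.prems, of i] neq that
    by (metis le_imp_less_Suc less_le_trans)
  show ?case
  proof (intro exI[of _ Y] ballI)
    fix i assume i: "i \<in> {0<..<Suc t}"
    show "(q i \<in> Y) \<noteq> (par (q i) \<in> Y) \<longleftrightarrow> {q i, par (q i)} \<in> M"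
    proof (cases "i = t")
      case True
      then show ?thesis using Y[OF par[of t]] i by (auto simp: Y_def)
    next
      case False
      then show ?thesis using Y[OF par[of i]] Y[OF neq[of i]] X[of i] i by auto
    qed
  qed
qed simp

lemma search_order_labelling:
  assumes "tree V E" "search_order E q par t" "q ` {..<t} = V"
    and X: "\<And>i. 0 < i \<Longrightarrow> i < t \<Longrightarrow> (q i \<in> X) \<noteq> (par (q i) \<in> X) \<longleftrightarrow> {q i, par (q i)} \<in> M"
    and "{u, v} \<in> E"
  shows "(u \<in> X) \<noteq> (v \<in> X) \<longleftrightarrow> {u, v} \<in> M"
  using assms(1-3,5)
proof (rule search_order_edge_cases)
  fix i assume "0 < i" "i < t" "v = q i" "u = par v"
  then show ?thesis using X[of i] by (auto simp: insert_commute)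
qed (use X in auto)

text \<open>This covers vertices of any type, so the order comes from
  \<open>tree_search_order\<close> and not from a run of the machine. The sum form avoids truncated
  subtraction.\<close>

theorem tree_super_domination_number:
  assumes tree: "tree V E"
  shows "super_domination_number V E + matching_number E = card V"
proof -
  have sg: "simple_graph V E" using tree by (simp add: tree_def)
  obtain q par t where so: "search_order E q par t" "q ` {..<t} = V"
    using tree_search_order[OF tree] .
  obtain M where M: "matching E M" "card M = matching_number E" using maximum_matching[OF sg] .
  obtain X where "\<And>i. 0 < i \<Longrightarrow> i < t \<Longrightarrow>
      (q i \<in> X) \<noteq> (par (q i) \<in> X) \<longleftrightarrow> {q i, par (q i)} \<in> M"
    using labelling_exists[OF so(1), of M] unfolding Ball_def greaterThanLessThan_iff by meson
  note X = search_order_labelling[OF tree so this]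
  note D = super_dominating_of_labelling[OF sg M(1) X refl]
  show ?thesis using super_domination_number_eqI[OF sg D(1)] D(2) M(2) by simp
qed

section \<open>The greedy matching\<close>

text \<open>The vertices \<open>q i\<close> with \<open>i > c\<close> have been treated, in decreasing order of \<open>i\<close>; \<open>S\<close> is the
  set of vertices that have been matched to their parents. The last conjunct says that \<open>par ` S\<close>
  covers all edges from treated vertices to their parents.\<close>

definition greedy :: "(nat \<Rightarrow> 'a) \<Rightarrow> ('a \<Rightarrow> 'a) \<Rightarrow> nat \<Rightarrow> nat \<Rightarrow> 'a set \<Rightarrow> bool" where
  "greedy q par t c S \<longleftrightarrow>
     S \<subseteq> q ` {c<..<t} \<and> inj_on par S \<and> S \<inter> par ` S = {} \<and>
     (\<forall>i\<in>{c<..<t}. q i \<in> par ` S \<or> par (q i) \<in> par ` S)"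

lemma greedy_init: "t \<le> Suc c \<Longrightarrow> greedy q par t c {}"
  by (auto simp: greedy_def)

lemma greedy_step:
  assumes so: "search_order E q par t" and g: "greedy q par t c S" and c: "0 < c" "c < t"
  shows "greedy q par t (c - 1)
    (if q c \<notin> par ` S \<and> par (q c) \<notin> par ` S then insert (q c) S else S)"
proof -
  have set: "{c - Suc 0<..<t} = insert c {c<..<t}" using c by auto
  obtain j where j: "j < c" "par (q c) = q j" using search_order_parent[OF so c] .
  have S: "S \<subseteq> q ` {c<..<t}" using g by (simp add: greedy_def)
  have "q c \<noteq> q j" "q j \<notin> S"
    using search_order_inj[OF so] j c S by fastforce+
  then show ?thesis using g j by (auto simp: greedy_def set)
qed

text \<open>Weak duality: disjoint edges need distinct vertices of the cover.\<close>

lemma card_matching_le_cover: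
  assumes M: "matching E M" and fin: "finite C" and C: "\<And>e. e \<in> E \<Longrightarrow> e \<inter> C \<noteq> {}"
  shows "card M \<le> card C"
proof -
  have "\<forall>e\<in>M. \<exists>x. x \<in> e \<inter> C" using C M by (auto simp: matching_def)
  then obtain f where f: "\<And>e. e \<in> M \<Longrightarrow> f e \<in> e \<inter> C" by metis
  then have "inj_on f M" using matching_unique[OF M] by (metis IntD1 inj_onI)
  then show ?thesis using card_inj_on_le[of f M C] f fin by blast
qed

lemma greedy_maximum:
  assumes tree: "tree V E" and so: "search_order E q par t" "q ` {..<t} = V"
    and g: "greedy q par t 0 S"
  defines "M \<equiv> (\<lambda>v. {v, par v}) ` S"
  shows "matching E M" "card M = matching_number E" "\<Union>M = S \<union> par ` S"
    and "\<And>i. 0 < i \<Longrightarrow> i < t \<Longrightarrow> {q i, par (q i)} \<in> M \<longleftrightarrow> q i \<in> S"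
proof -
  have sg: "simple_graph V E" using tree by (simp add: tree_def)
  have S: "S \<subseteq> q ` {0<..<t}" "inj_on par S" "S \<inter> par ` S = {}"
    and cover: "\<And>i. 0 < i \<Longrightarrow> i < t \<Longrightarrow> q i \<in> par ` S \<or> par (q i) \<in> par ` S"
    using g by (auto simp: greedy_def)
  have par: "{v, par v} \<in> E" if v: "v \<in> S" for v
  proof -
    obtain i where i: "v = q i" "0 < i" "i < t" using S(1) v by auto
    obtain j where "par (q i) = q j" "{q j, q i} \<in> E" using search_order_parent[OF so(1) i(2,3)] .
    then show ?thesis using i by (simp add: insert_commute)
  qed
  have "disjnt {v, par v} {w, par w}" if "v \<in> S" "w \<in> S" "v \<noteq> w" for v w
  proof -
    have "par v \<noteq> par w" "v \<noteq> par w" "w \<noteq> par v" using S(2,3) that by (auto dest: inj_onD)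
    then show ?thesis using that by (simp add: disjnt_def)
  qed
  then show M: "matching E M"
    using par unfolding matching_def M_def
    by (intro conjI pairwise_imageI image_subsetI)
  have finS: "finite S" using S(1) finite_subset by blast
  have inj: "inj_on (\<lambda>v. {v, par v}) S"
    using S(3) by (fastforce simp: inj_on_def doubleton_eq_iff)
  then have cM: "card M = card (par ` S)" using S(2) by (simp add: M_def card_image)
  have C: "e \<inter> par ` S \<noteq> {}" if "e \<in> E" for e
  proof -
    have "card e = 2" using that sg by (auto simp: simple_graph_def)
    then obtain u v where uv: "e = {u, v}" by (auto simp: card_2_iff)
    have "{u, v} \<in> E" using that uv by simp
    from search_order_edge_cases[OF tree so this] show ?thesis
      by cases (use cover uv in auto)
  qed
  have "matching_number E \<le> card M"
    using maximum_matching[OF sg] card_matching_le_cover[OF _ finite_imageI[OF finS] C] cM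
    by metis
  then show "card M = matching_number E" using card_matching_le[OF sg M] by simp
  show "\<Union>M = S \<union> par ` S" by (auto simp: M_def)
  show "{q i, par (q i)} \<in> M \<longleftrightarrow> q i \<in> S" if i: "0 < i" "i < t" for i
  proof
    assume "{q i, par (q i)} \<in> M"
    then obtain v where v: "v \<in> S" "{q i, par (q i)} = {v, par v}" by (auto simp: M_def)
    then obtain k where k: "v = q k" "0 < k" "k < t" using S(1) by auto
    obtain j where j: "j < i" "par (q i) = q j" using search_order_parent[OF so(1) i] .
    obtain l where l: "l < k" "par (q k) = q l" using search_order_parent[OF so(1) k(2,3)] .
    \<comment> \<open>The crossed case \<open>q i = par v\<close>, \<open>par (q i) = v\<close>
      would give \<open>i = l < k\<close> and \<open>k = j < i\<close>.\<close>
    have "q i = q k"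
      using v(2) k j l i search_order_inj[OF so(1)]
      by (auto simp: doubleton_eq_iff)
    then show "q i \<in> S" using v k by simp
  qed (simp add: M_def)
qed

section \<open>Reasoning about the random access machine\<close>

text \<open>Total correctness with time: the postcondition also receives the running time. By
  \<open>exec_deterministic\<close> the run that exists is the only one.\<close>

definition wp :: "program \<Rightarrow> memory \<Rightarrow> (nat \<Rightarrow> memory \<Rightarrow> bool) \<Rightarrow> bool" where
  "wp p s Q \<longleftrightarrow> (\<exists>t s'. exec p s t s' \<and> Q t s')"

inductive_cases exec_cases:
  "exec Skip s t s'" "exec (Const r k) s t s'" "exec (Copy r q) s t s'" "exec (Inc r) s t s'"
  "exec (Dec r) s t s'" "exec (Load r a q) s t s'" "exec (Store a r q) s t s'"
  "exec (Seq p p') s t s'" "exec (Branch b p p') s t s'"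

lemma wp_simps:
  "wp Skip s Q \<longleftrightarrow> Q 1 s"
  "wp (Const r k) s Q \<longleftrightarrow> Q 1 (set_reg r k s)"
  "wp (Copy r q) s Q \<longleftrightarrow> Q 1 (set_reg r (regs s q) s)"
  "wp (Inc r) s Q \<longleftrightarrow> Q 1 (set_reg r (regs s r + 1) s)"
  "wp (Dec r) s Q \<longleftrightarrow> Q 1 (set_reg r (regs s r - 1) s)"
  "wp (Load r a q) s Q \<longleftrightarrow> Q 1 (set_reg r (arrs s a (regs s q)) s)"
  "wp (Store a r q) s Q \<longleftrightarrow> Q 1 (set_cell a (regs s r) (regs s q) s)"
  "wp (Seq p p') s Q \<longleftrightarrow> wp p s (\<lambda>t s'. wp p' s' (\<lambda>t' s''. Q (t + t') s''))"
  "wp (Branch b p p') s Q \<longleftrightarrow>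
    (if holds b s then wp p s (\<lambda>t. Q (1 + t)) else wp p' s (\<lambda>t. Q (1 + t)))"
  unfolding wp_def by (auto intro: exec.intros[simplified] elim!: exec_cases)

lemma wp_mono: "wp p s Q \<Longrightarrow> (\<And>t s'. Q t s' \<Longrightarrow> R t s') \<Longrightarrow> wp p s R"
  by (auto simp: wp_def)

text \<open>The potential \<open>\<Phi>\<close> pays for each iteration together with its test, and
  the extra 1 for the final failing test. As every test costs 1, \<open>\<Phi>\<close> strictly
  decreases, so it also proves termination.\<close>

lemma wp_Loop:
  assumes "I s"
    and step: "\<And>s. I s \<Longrightarrow> holds b s \<Longrightarrow> wp p s (\<lambda>t s'. I s' \<and> 1 + t + \<Phi> s' \<le> (\<Phi> s :: nat))"
  shows "wp (Loop b p) s (\<lambda>t s'. I s' \<and> \<not> holds b s' \<and> t + \<Phi> s' \<le> \<Phi> s + 1)"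
  using \<open>I s\<close>
proof (induction "\<Phi> s" arbitrary: s rule: less_induct)
  case less
  show ?case
  proof (cases "holds b s")
    case True
    then obtain t s' where s': "exec p s t s'" "I s'" "1 + t + \<Phi> s' \<le> \<Phi> s"
      using step[OF less.prems] by (auto simp: wp_def)
    then obtain t' s'' where "exec (Loop b p) s' t' s''" "I s''" "\<not> holds b s''"
      "t' + \<Phi> s'' \<le> \<Phi> s' + 1"
      using less.hyps[of s'] by (auto simp: wp_def)
    then show ?thesis unfolding wp_def using s' exec.Loop_True[OF True s'(1)]
      by (intro exI[of _ "1 + t + t'"] exI[of _ s'']) auto
  next
    case False
    then show ?thesis unfolding wp_def using less.prems exec.Loop_False[OF False, of p]
      by (intro exI[of _ 1] exI[of _ s]) auto
  qed
qed

lemma memory_simps [simp]: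
  "regs (set_reg r k s) = (regs s)(r := k)"
  "arrs (set_reg r k s) = arrs s"
  "regs (set_cell a i k s) = regs s"
  "arrs (set_cell a i k s) = (arrs s)(a := (arrs s a)(i := k))"
  by (simp_all add: set_reg_def set_cell_def)

abbreviation seq (infixr ";;" 60) where "p ;; p' \<equiv> Seq p p'"

section \<open>The program\<close>

text \<open>Register 0 holds the number of vertices, registers 8 and 9 hold the constants 0 and 1. The
  arrays 3 to 8 hold the search order (also used as the queue of the breadth-first search), the
  parents, the visited vertices, the vertices matched to a child, the vertices matched to their
  parent, and the labels. The root of the search is vertex 0.\<close>

definition visit :: program where
  "visit =
    Load 6 1 4 ;; Load 7 5 6 ;;
    Branch (Equal 7 8) (Store 5 6 9 ;; Store 4 6 3 ;; Store 3 2 6 ;; Inc 2) Skip ;;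
    Inc 4"

text \<open>Registers 1 and 2 are head and tail of the queue, 3 is the current vertex, and 4 and 5
  delimit the unread part of its adjacency list.\<close>

definition search :: program where
  "search =
    Const 9 1 ;; Store 5 8 9 ;; Copy 2 9 ;;
    Loop (Less 1 2)
      (Load 3 3 1 ;; Load 4 0 3 ;; Copy 7 3 ;; Inc 7 ;; Load 5 0 7 ;;
       Loop (Less 4 5) visit ;; Inc 1)"

definition match :: program where
  "match =
    Copy 1 0 ;; Dec 1 ;;
    Loop (Less 8 1)
      (Load 3 3 1 ;; Load 6 4 3 ;; Load 4 6 3 ;; Load 5 6 6 ;;
       Branch (Equal 4 8) (Branch (Equal 5 8) (Store 7 3 9 ;; Store 6 6 9) Skip) Skip ;;
       Dec 1)"

text \<open>Register 4 carries the parent's label, flipped if the vertex is matched to its parent.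
  Array 2 receives 0 only at matched vertices whose label is 1.\<close>

definition label :: program where
  "label =
    Loop (Less 1 0)
      (Load 3 3 1 ;; Load 6 4 3 ;; Load 4 8 6 ;; Load 5 7 3 ;; Load 7 6 3 ;;
       Branch (Equal 5 8) Skip (Branch (Equal 4 8) (Const 4 1) (Const 4 0)) ;;
       Store 8 3 4 ;; Store 2 3 8 ;;
       Branch (Equal 4 8) (Store 2 3 9)
         (Branch (Equal 5 8) (Branch (Equal 7 8) (Store 2 3 9) Skip) Skip) ;;
       Inc 1)"

section \<open>Correctness and running time\<close>

text \<open>Here \<open>h\<close> and \<open>t\<close> are head and tail of the queue: the vertices
  before \<open>h\<close> have been fully explored.\<close>

definition searched ::
  "nat set \<Rightarrow> nat set set \<Rightarrow> (nat \<Rightarrow> nat) \<Rightarrow> (nat \<Rightarrow> nat) \<Rightarrow> (nat \<Rightarrow> nat) \<Rightarrow> nat \<Rightarrow> nat \<Rightarrow> bool"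
  where
  "searched V E q par vis h t \<longleftrightarrow>
     search_order E q par t \<and> 0 < t \<and> q ` {..<t} \<subseteq> V \<and> {v. vis v \<noteq> 0} = q ` {..<t} \<and>
     (\<forall>i<h. nbh E (q i) \<subseteq> q ` {..<t})"

lemma searched_extend:
  assumes sg: "simple_graph V E" and s: "searched V E q par vis h t"
    and h: "h < t" "{q h, u} \<in> E" and u: "vis u = 0"
  shows "searched V E (q(t := u)) (par(u := q h)) (vis(u := 1)) h (Suc t)"
proof -
  have vis: "{v. vis v \<noteq> 0} = q ` {..<t}" using s by (simp add: searched_def)
  then have nu: "u \<notin> q ` {..<t}" using u by blast
  have img: "(q(t := u)) ` {..<Suc t} = insert u (q ` {..<t})"
    by (auto simp: less_Suc_eq image_iff)
  have "u \<in> V" using simple_graph_edgeD[OF sg h(2)] by simp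
  moreover have "{v. (vis(u := 1)) v \<noteq> 0} = insert u (q ` {..<t})"
    unfolding vis[symmetric] by auto
  moreover have "search_order E (q(t := u)) (par(u := q h)) (Suc t)"
    using search_order_extend[OF _ h nu] s by (simp add: searched_def)
  ultimately show ?thesis
    using s h(1) unfolding searched_def img by auto
qed

section \<open>The input encoding and the degree sum\<close>

locale tree_input =
  fixes V :: "nat set" and E adj
  assumes tree: "tree V E" and adj: "adjacency_lists V E adj"
begin

abbreviation n where "n \<equiv> length adj"
abbreviation offset where "offset v \<equiv> length (concat (take v adj))"

lemma sg: "simple_graph V E" and conn: "connected_graph V E"
  using tree by (auto simp: tree_def)

lemma V: "V = {..<n}" and adj_nbh: "v < n \<Longrightarrow> set (adj ! v) = nbh E v"
  and adj_distinct: "v < n \<Longrightarrow> distinct (adj ! v)"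
  using adj by (auto simp: adjacency_lists_def)

lemma n_pos: "0 < n"
  using conn V by (auto simp: connected_graph_def)

definition "in_place (s :: memory) \<longleftrightarrow>
  regs s 0 = n \<and> regs s 8 = 0 \<and> regs s 9 = 1 \<and>
  arrs s 0 = arrs (input_memory adj) 0 \<and> arrs s 1 = arrs (input_memory adj) 1"

lemma concat_split:
  assumes "v < n" shows "concat adj = concat (take v adj) @ adj ! v @ concat (drop (Suc v) adj)"
  using assms by (metis append_take_drop_id concat.simps(2) concat_append id_take_nth_drop)

lemma offset_Suc: "v < n \<Longrightarrow> offset (Suc v) = offset v + length (adj ! v)"
  by (simp add: take_Suc_conv_app_nth)

lemma input_offset: "v \<le> n \<Longrightarrow> arrs (input_memory adj) 0 v = offset v"
  by (simp add: input_memory_def)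

lemma input_entry:
  assumes "v < n" "j < length (adj ! v)"
  shows "arrs (input_memory adj) 1 (offset v + j) = adj ! v ! j"
  using assms concat_split[OF assms(1)] by (simp add: input_memory_def nth_append)

text \<open>Handshake count: an ordered pair of adjacent vertices is recovered from its edge and one
  bit of orientation.\<close>

lemma sum_degrees: "(\<Sum>v\<in>V. length (adj ! v)) \<le> 2 * card E"
proof -
  have finE: "finite E" using simple_graph_finite_edges[OF sg] .
  have finV: "finite V" using sg by (simp add: simple_graph_def)
  have "(\<Sum>v\<in>V. length (adj ! v)) = (\<Sum>v\<in>V. card (nbh E v))"
    using V adj_nbh adj_distinct by (intro sum.cong) (auto simp: distinct_card[symmetric])
  also have "\<dots> = card (Sigma V (nbh E))"
    using finV V adj_nbh by (subst card_SigmaI) (auto, metis List.finite_set)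
  also have "\<dots> \<le> card (E \<times> (UNIV :: bool set))"
  proof (rule card_inj_on_le[of "\<lambda>(v, u). ({v, u}, v < u)"])
    show "inj_on (\<lambda>(v, u). ({v, u}, v < u)) (Sigma V (nbh E))"
      using simple_graph_edgeD(3)[OF sg]
      by (auto simp: inj_on_def nbh_def doubleton_eq_iff)
  qed (use finE in \<open>auto simp: nbh_def\<close>)
  also have "\<dots> = 2 * card E" by (simp add: card_cartesian_product)
  finally show ?thesis .
qed

section \<open>Breadth-first search with amortized running time\<close>

definition "searching (s :: memory) \<longleftrightarrow>
  in_place s \<and> (\<forall>a\<in>{6, 7, 8}. arrs s a = (\<lambda>_. 0)) \<and>
  searched V E (arrs s 3) (arrs s 4) (arrs s 5) (regs s 1) (regs s 2)"

text \<open>While the neighbors of vertex \<open>h\<close> of the queue are visited; \<open>W\<close> is the set of its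
  predecessors in the queue.\<close>

definition "visiting h W s \<longleftrightarrow>
  searching s \<and> regs s 1 = h \<and> h < regs s 2 \<and> arrs s 3 h = regs s 3 \<and> arrs s 3 ` {..<h} = W \<and>
  regs s 5 = offset (regs s 3) + length (adj ! regs s 3) \<and>
  (\<exists>j\<le>length (adj ! regs s 3). regs s 4 = offset (regs s 3) + j \<and>
    set (take j (adj ! regs s 3)) \<subseteq> arrs s 3 ` {..<regs s 2})"

text \<open>Each adjacency entry is charged 9: at most eight units in the body and one for the loop
  test.\<close>

lemma visit:
  assumes vis: "visiting h W s" and less: "regs s 4 < regs s 5"
  shows "wp visit s (\<lambda>t s'. visiting h W s' \<and> regs s' 3 = regs s 3 \<and>
    1 + t + 9 * (regs s' 5 - regs s' 4) \<le> 9 * (regs s 5 - regs s 4))"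
proof -
  let ?v = "regs s 3" and ?q = "arrs s 3" and ?t = "regs s 2"
  obtain j where j: "j \<le> length (adj ! ?v)" "regs s 4 = offset ?v + j"
    "set (take j (adj ! ?v)) \<subseteq> ?q ` {..<?t}"
    using vis by (auto simp: visiting_def)
  have h: "regs s 1 = h" "h < ?t" "?q h = ?v" "?q ` {..<h} = W"
    "regs s 5 = offset ?v + length (adj ! ?v)"
    using vis by (simp_all add: visiting_def)
  have sd: "searched V E ?q (arrs s 4) (arrs s 5) h ?t" and ip: "in_place s"
    and blank: "arrs s 6 = (\<lambda>_. 0)" "arrs s 7 = (\<lambda>_. 0)" "arrs s 8 = (\<lambda>_. 0)"
    using vis h(1) unfolding visiting_def searching_def by auto
  have v: "?v < n" using sd h V by (auto simp: searched_def)
  have jl: "j < length (adj ! ?v)" using less h j by simp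
  define u where "u = adj ! ?v ! j"
  have u: "arrs s 1 (regs s 4) = u"
    using ip input_entry[OF v jl] j by (simp add: in_place_def u_def)
  have edge: "{?q h, u} \<in> E"
    using adj_nbh[OF v] jl nth_mem[OF jl] h by (simp add: u_def nbh_def)
  have take: "set (take (Suc j) (adj ! ?v)) = insert u (set (take j (adj ! ?v)))"
    using jl by (simp add: take_Suc_conv_app_nth u_def)
  have visited: "{v. arrs s 5 v \<noteq> 0} = ?q ` {..<?t}" using sd by (simp add: searched_def)
  show ?thesis
  proof (cases "arrs s 5 u = 0")
    case True
    note ext = searched_extend[OF sg sd h(2) edge True]
    \<comment> \<open>The new vertex is written at the tail, beyond the head, so the part of the
      queue before \<open>h\<close> stays intact.\<close>
    have img: "(?q(?t := u)) ` {..<h} = W" using h by auto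
    have img': "(?q(?t := u)) ` {..<Suc ?t} = insert u (?q ` {..<?t})"
      by (auto simp: less_Suc_eq image_iff)
    show ?thesis
      using ip blank h j jl u True ext less img img' take
      unfolding visit_def wp_simps visiting_def searching_def in_place_def
      by (auto intro!: exI[of _ "Suc j"])
  next
    case False
    then have "u \<in> ?q ` {..<?t}" using visited by blast
    then show ?thesis
      using ip blank h j jl u sd less take False
      unfolding visit_def wp_simps visiting_def searching_def in_place_def
      by (auto intro!: exI[of _ "Suc j"])
  qed
qed

lemma search:
  "wp search (input_memory adj) (\<lambda>t s. in_place s \<and> (\<forall>a\<in>{6, 7, 8}. arrs s a = (\<lambda>_. 0)) \<and>
    search_order E (arrs s 3) (arrs s 4) n \<and> arrs s 3 ` {..<n} = V \<and>
    t \<le> 4 + 8 * n + 18 * card E)"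
proof -
  \<comment> \<open>Each vertex still to be dequeued is charged 8 for the outer loop, and each entry
    of its list 9 for the inner loop.\<close>
  let ?rest = "\<lambda>s. \<Sum>v\<in>V - arrs s 3 ` {..<regs s 1}. length (adj ! v)"
  let ?\<Phi> = "\<lambda>s. 8 * (n - regs s 1) + 9 * ?rest s"
  let ?I = "\<lambda>s. searching s \<and> regs s 1 \<le> regs s 2"
  let ?body = "Load 3 3 1 ;; Load 4 0 3 ;; Copy 7 3 ;; Inc 7 ;; Load 5 0 7 ;;
       Loop (Less 4 5) visit ;; Inc 1"
  have finV: "finite V" using V by simp
  have body: "wp ?body s (\<lambda>t s'. ?I s' \<and> 1 + t + ?\<Phi> s' \<le> ?\<Phi> s)"
    if I: "?I s" and less: "holds (Less 1 2) s" for s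
  proof -
    let ?h = "regs s 1"
    define v where "v = arrs s 3 ?h"
    define W where "W = arrs s 3 ` {..<?h}"
    have h: "?h < regs s 2" using less by simp
    have sd: "searched V E (arrs s 3) (arrs s 4) (arrs s 5) ?h (regs s 2)"
      using I by (simp add: searching_def)
    have "v \<in> V" using sd h by (auto simp: searched_def v_def)
    then have v: "v < n" using V by simp
    have "card (arrs s 3 ` {..<regs s 2}) = regs s 2"
      using sd by (simp add: searched_def search_order_def card_image)
    \<comment> \<open>Without this bound the truncated difference \<open>n - regs s 1\<close> might
      fail to drop.\<close>
    then have tn: "regs s 2 \<le> n"
      using sd card_mono[of V "arrs s 3 ` {..<regs s 2}"] V by (simp add: searched_def)
    have "v \<notin> W"
      using sd h unfolding searched_def v_def W_def by (auto simp: search_order_inj)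
    then have rest: "?rest s = length (adj ! v) + (\<Sum>v\<in>V - insert v W. length (adj ! v))"
      using sum.remove[of "V - W" v "\<lambda>v. length (adj ! v)"] finV \<open>v \<in> V\<close>
      by (simp only: W_def[symmetric] Diff_insert[of V v W] finite_Diff Diff_iff simp_thms)
    let ?s = "set_reg 5 (offset (Suc v)) (set_reg 7 (Suc v) (set_reg 7 v
      (set_reg 4 (offset v) (set_reg 3 v s))))"
    have init: "visiting ?h W ?s"
      using I h v offset_Suc[OF v] by (auto simp: visiting_def searching_def in_place_def v_def W_def)
    have loop: "wp (Loop (Less 4 5) visit) ?s (\<lambda>t s'. (visiting ?h W s' \<and> regs s' 3 = v) \<and>
        \<not> holds (Less 4 5) s' \<and>
        t + 9 * (regs s' 5 - regs s' 4) \<le> 9 * (regs ?s 5 - regs ?s 4) + 1)"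
      by (rule wp_Loop) (use init visit in auto)
    \<comment> \<open>The 7 pays for the five instructions before the inner loop, the increment
      after it and the outer test.\<close>
    have "wp (Loop (Less 4 5) visit) ?s (\<lambda>t s'. ?I (set_reg 1 (regs s' 1 + 1) s') \<and>
        t + ?\<Phi> (set_reg 1 (regs s' 1 + 1) s') + 7 \<le> ?\<Phi> s)"
    proof (rule wp_mono[OF loop], intro conjI)
      fix t s'
      assume *: "(visiting ?h W s' \<and> regs s' 3 = v) \<and> \<not> holds (Less 4 5) s' \<and>
        t + 9 * (regs s' 5 - regs s' 4) \<le> 9 * (regs ?s 5 - regs ?s 4) + 1"
      let ?q = "arrs s' 3"
      have s': "regs s' 1 = ?h" "?h < regs s' 2" "?q ?h = v" "?q ` {..<?h} = W" "searching s'"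
        using * by (simp_all add: visiting_def)
      obtain j where j: "j \<le> length (adj ! v)" "regs s' 4 = offset v + j"
        "set (take j (adj ! v)) \<subseteq> ?q ` {..<regs s' 2}"
        "regs s' 5 = offset v + length (adj ! v)"
        using * by (auto simp: visiting_def)
      then have "j = length (adj ! v)" using * by simp
      then have nb: "nbh E (?q ?h) \<subseteq> ?q ` {..<regs s' 2}" using j adj_nbh[OF v] s' by simp
      show "searching (set_reg 1 (regs s' 1 + 1) s')"
        using s' nb by (auto simp: searching_def in_place_def searched_def less_Suc_eq)
      show "regs (set_reg 1 (regs s' 1 + 1) s') 1 \<le> regs (set_reg 1 (regs s' 1 + 1) s') 2"
        using s' by simp
      have "?q ` {..<Suc ?h} = insert v W" using s' by (simp add: lessThan_Suc)
      moreover have "t \<le> 9 * length (adj ! v) + 1" using * offset_Suc[OF v] by simp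
      ultimately show "t + ?\<Phi> (set_reg 1 (regs s' 1 + 1) s') + 7 \<le> ?\<Phi> s"
        using rest s' h tn by simp
    qed
    then have "wp (Loop (Less 4 5) visit) ?s (\<lambda>t s'. ?I (set_reg 1 (regs s' 1 + 1) s') \<and>
        1 + (1 + (1 + (1 + (1 + (1 + (t + 1)))))) + ?\<Phi> (set_reg 1 (regs s' 1 + 1) s') \<le> ?\<Phi> s)"
      by (rule wp_mono) auto
    moreover have "arrs s 0 v = offset v" "arrs s 0 (Suc v) = offset (Suc v)"
      using I v input_offset by (simp_all add: searching_def in_place_def)
    ultimately show ?thesis
      unfolding wp_simps by (simp add: v_def)
  qed
  \<comment> \<open>Array 3 is blank, so its cell 0 already holds the root 0; setting the tail to 1
    enqueues it.\<close>
  let ?s = "set_reg 2 1 (set_cell 5 0 1 (set_reg 9 1 (input_memory adj)))"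
  have "searched V E (arrs ?s 3) (arrs ?s 4) (arrs ?s 5) 0 1"
    using n_pos V by (auto simp: searched_def search_order_def input_memory_def inj_on_def)
  then have init: "?I ?s" by (auto simp: searching_def in_place_def input_memory_def)
  have bound: "?\<Phi> ?s \<le> 8 * n + 18 * card E"
    using sum_degrees by (simp add: input_memory_def)
  have "wp (Loop (Less 1 2) ?body) ?s (\<lambda>t s. ?I s \<and> \<not> holds (Less 1 2) s \<and>
      t + ?\<Phi> s \<le> ?\<Phi> ?s + 1)"
    by (rule wp_Loop[where I = ?I and \<Phi> = ?\<Phi>]) (fact init, fact body)
  then have loop: "wp (Loop (Less 1 2) ?body) ?s (\<lambda>t s. ?I s \<and> \<not> holds (Less 1 2) s \<and>
      t \<le> 8 * n + 18 * card E + 1)"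
    by (rule wp_mono) (use bound in linarith)
  have "wp (Loop (Less 1 2) ?body) ?s (\<lambda>t s. in_place s \<and> (\<forall>a\<in>{6, 7, 8}. arrs s a = (\<lambda>_. 0)) \<and>
    search_order E (arrs s 3) (arrs s 4) n \<and> arrs s 3 ` {..<n} = V \<and>
    1 + (1 + (1 + t)) \<le> 4 + 8 * n + 18 * card E)"
  proof (rule wp_mono[OF loop])
    fix t s assume *: "?I s \<and> \<not> holds (Less 1 2) s \<and> t \<le> 8 * n + 18 * card E + 1"
    \<comment> \<open>On exit the head has met the tail, so every listed vertex is explored.\<close>
    then have sd: "searched V E (arrs s 3) (arrs s 4) (arrs s 5) (regs s 2) (regs s 2)"
      by (auto simp: searching_def)
    have eq: "arrs s 3 ` {..<regs s 2} = V"
      using sd by (intro search_order_closed[OF conn]) (auto simp: searched_def)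
    moreover have "card (arrs s 3 ` {..<regs s 2}) = regs s 2"
      using sd by (simp add: searched_def search_order_def card_image)
    ultimately have "regs s 2 = n" using V by simp
    then show "in_place s \<and> (\<forall>a\<in>{6, 7, 8}. arrs s a = (\<lambda>_. 0)) \<and>
        search_order E (arrs s 3) (arrs s 4) n \<and> arrs s 3 ` {..<n} = V \<and>
        1 + (1 + (1 + t)) \<le> 4 + 8 * n + 18 * card E"
      using * eq sd by (simp add: searching_def searched_def)
  qed
  then show ?thesis
    unfolding search_def wp_simps by (simp add: input_memory_def)
qed

section \<open>The matching pass and the labelling pass\<close>

definition "ordered q par (s :: memory) \<longleftrightarrow> in_place s \<and> arrs s 3 = q \<and> arrs s 4 = par"

definition "matched par S (s :: memory) \<longleftrightarrow>
  (\<forall>v. arrs s 7 v = 0 \<longleftrightarrow> v \<notin> S) \<and> (\<forall>v. arrs s 6 v = 0 \<longleftrightarrow> v \<notin> par ` S)"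

text \<open>Register 1 is the bound \<open>c\<close> of \<open>greedy\<close>. It starts at
  \<open>n - 1\<close>, where nothing has been treated, and stops at 0 because the root has no
  parent. An iteration costs at most 10 with its test.\<close>

lemma match:
  assumes so: "search_order E q par n" and init: "ordered q par s"
    and blank: "arrs s 6 = (\<lambda>_. 0)" "arrs s 7 = (\<lambda>_. 0)"
  shows "wp match s (\<lambda>t s'. ordered q par s' \<and> regs s' 1 = 0 \<and>
    (\<exists>S. greedy q par n 0 S \<and> matched par S s') \<and> t \<le> 3 + 10 * n)"
proof -
  let ?I = "\<lambda>s. ordered q par s \<and> regs s 1 < n \<and>
    (\<exists>S. greedy q par n (regs s 1) S \<and> matched par S s)"
  let ?body = "Load 3 3 1 ;; Load 6 4 3 ;; Load 4 6 3 ;; Load 5 6 6 ;;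
       Branch (Equal 4 8) (Branch (Equal 5 8) (Store 7 3 9 ;; Store 6 6 9) Skip) Skip ;; Dec 1"
  have body: "wp ?body s (\<lambda>t s'. ?I s' \<and> 1 + t + 10 * regs s' 1 \<le> 10 * regs s 1)"
    if I: "?I s" and less: "holds (Less 8 1) s" for s
  proof -
    let ?c = "regs s 1" and ?v = "q (regs s 1)"
    obtain S where S: "greedy q par n ?c S" "matched par S s" and ord: "ordered q par s"
      and cn: "?c < n" using I by auto
    have c: "0 < ?c" using less ord by (simp add: ordered_def in_place_def)
    note step = greedy_step[OF so S(1) c cn]
    have C: "arrs s 6 w = 0 \<longleftrightarrow> w \<notin> par ` S" for w
      using S(2) by (simp add: matched_def)
    have U: "arrs s 7 w = 0 \<longleftrightarrow> w \<notin> S" for w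
      using S(2) by (simp add: matched_def)
    show ?thesis
    proof (cases "?v \<notin> par ` S \<and> par ?v \<notin> par ` S")
      case True
      then have "greedy q par n (?c - 1) (insert ?v S)" using step by simp
      then show ?thesis using True ord cn c
        unfolding wp_simps
        by (auto simp: C U ordered_def in_place_def matched_def intro!: exI[of _ "insert ?v S"])
    next
      case False
      then have "greedy q par n (?c - 1) S" using step by (simp split: if_splits)
      then show ?thesis using False ord cn c S(2)
        unfolding wp_simps
        by (auto simp: C U ordered_def in_place_def matched_def intro!: exI[of _ S])
    qed
  qed
  let ?s = "set_reg 1 (n - 1) (set_reg 1 n s)"
  have "greedy q par n (n - 1) {}" by (rule greedy_init) simp
  then have "?I ?s" using init n_pos blank
    by (auto simp: ordered_def in_place_def matched_def intro!: exI[of _ "{}"])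
  then have "wp (Loop (Less 8 1) ?body) ?s (\<lambda>t s'. ?I s' \<and> \<not> holds (Less 8 1) s' \<and>
      t + 10 * regs s' 1 \<le> 10 * regs ?s 1 + 1)"
    by (rule wp_Loop[where I = ?I and \<Phi> = "\<lambda>s. 10 * regs s 1"]) (fact body)
  then have "wp (Loop (Less 8 1) ?body) ?s (\<lambda>t s'. ordered q par s' \<and> regs s' 1 = 0 \<and>
    (\<exists>S. greedy q par n 0 S \<and> matched par S s') \<and> 1 + (1 + t) \<le> 3 + 10 * n)"
    by (rule wp_mono) (auto simp: ordered_def in_place_def)
  then show ?thesis using init
    unfolding match_def wp_simps by (simp add: ordered_def in_place_def)
qed

text \<open>\<open>X\<close> is the set of vertices with nonzero label. Parents are labelled before
  their children and their labels are never overwritten, so the constraints already met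
  persist.\<close>

lemma label:
  assumes so: "search_order E q par n"
    and init: "ordered q par s" "matched par S s" "regs s 1 = 0"
  shows "wp label s (\<lambda>t s'. (\<exists>X.
    (\<forall>k. 0 < k \<longrightarrow> k < n \<longrightarrow> (q k \<in> X) \<noteq> (par (q k) \<in> X) \<longleftrightarrow> q k \<in> S) \<and>
    (\<forall>k<n. arrs s' 2 (q k) = 0 \<longleftrightarrow> q k \<in> X \<inter> (S \<union> par ` S))) \<and> t \<le> 1 + 16 * n)"
proof -
  define I where "I s \<longleftrightarrow> ordered q par s \<and> matched par S s \<and> regs s 1 \<le> n \<and>
    (\<forall>k. 0 < k \<longrightarrow> k < regs s 1 \<longrightarrow>
      (arrs s 8 (q k) \<noteq> 0) \<noteq> (arrs s 8 (par (q k)) \<noteq> 0) \<longleftrightarrow> q k \<in> S) \<and>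
    (\<forall>k<regs s 1. arrs s 2 (q k) = 0 \<longleftrightarrow> arrs s 8 (q k) \<noteq> 0 \<and> q k \<in> S \<union> par ` S)" for s
  let ?body = "Load 3 3 1 ;; Load 6 4 3 ;; Load 4 8 6 ;; Load 5 7 3 ;; Load 7 6 3 ;;
       Branch (Equal 5 8) Skip (Branch (Equal 4 8) (Const 4 1) (Const 4 0)) ;;
       Store 8 3 4 ;; Store 2 3 8 ;;
       Branch (Equal 4 8) (Store 2 3 9)
         (Branch (Equal 5 8) (Branch (Equal 7 8) (Store 2 3 9) Skip) Skip) ;;
       Inc 1"
  have body: "wp ?body s (\<lambda>t s'. I s' \<and> 1 + t + 16 * (n - regs s' 1) \<le> 16 * (n - regs s 1))"
    if I: "I s" and less: "holds (Less 1 0) s" for s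
  proof -
    let ?i = "regs s 1" and ?v = "q (regs s 1)" and ?L = "arrs s 8"
    have ord: "ordered q par s" and m: "matched par S s" using I by (simp_all add: I_def)
    have i: "?i < n" using less ord by (simp add: ordered_def in_place_def)
    have C: "arrs s 6 w = 0 \<longleftrightarrow> w \<notin> par ` S" for w
      using m by (simp add: matched_def)
    have U: "arrs s 7 w = 0 \<longleftrightarrow> w \<notin> S" for w
      using m by (simp add: matched_def)
    have neq: "q k \<noteq> ?v" if "k < ?i" for k
      using search_order_inj[OF so] that i by auto
    have par: "par (q k) \<noteq> ?v" if "0 < k" "k \<le> ?i" for k
    proof -
      have "k < n" using that i by simp
      then obtain j where "j < k" "par (q k) = q j"
        using search_order_parent[OF so \<open>0 < k\<close>] by blast
      then show ?thesis using neq[of j] that by simp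
    qed
    \<comment> \<open>With the new label \<open>l\<close> and the new output \<open>r\<close> left
      general, one argument serves all branches of the body.\<close>
    have step: "I s'"
      if s': "ordered q par s'" "matched par S s'" "regs s' 1 = Suc ?i"
        and L: "arrs s' 8 = ?L(?v := l)" "l \<noteq> 0 \<longleftrightarrow> (?L (par ?v) \<noteq> 0) \<noteq> (?v \<in> S)"
        and out: "arrs s' 2 = (arrs s 2)(?v := r)" "r = 0 \<longleftrightarrow> l \<noteq> 0 \<and> ?v \<in> S \<union> par ` S"
      for s' l r
      unfolding I_def
    proof (intro conjI allI impI)
      fix k assume k: "0 < k" "k < regs s' 1"
      show "(arrs s' 8 (q k) \<noteq> 0) \<noteq> (arrs s' 8 (par (q k)) \<noteq> 0) \<longleftrightarrow> q k \<in> S"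
      proof (cases "k = ?i")
        case True
        then show ?thesis using L k par[of k] by auto
      next
        case False
        then have "k < ?i" using k s' by simp
        then show ?thesis using L I k par[of k] neq[of k] by (simp add: I_def)
      qed
    next
      fix k assume k: "k < regs s' 1"
      show "arrs s' 2 (q k) = 0 \<longleftrightarrow> arrs s' 8 (q k) \<noteq> 0 \<and> q k \<in> S \<union> par ` S"
      proof (cases "k = ?i")
        case True
        then show ?thesis using L(1) out by simp
      next
        case False
        then have "k < ?i" using k s' by simp
        then show ?thesis using L out I neq[of k] by (simp add: I_def)
      qed
    qed (use s' i in auto)
    have regs: "regs s 0 = n" "regs s 8 = 0" "regs s 9 = 1"
      and arrs: "arrs s 3 = q" "arrs s 4 = par"
      using ord by (simp_all add: ordered_def in_place_def)
    show ?thesis unfolding wp_simps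
      \<comment> \<open>These three facts decide every test in the body.\<close>
      by (cases "?v \<in> S"; cases "?L (par ?v) = 0"; cases "?v \<in> par ` S")
        (use i ord m in \<open>auto simp: regs arrs C U ordered_def in_place_def matched_def intro!: step\<close>)
  qed
  have "I s" using init by (simp add: I_def)
  then have loop: "wp (Loop (Less 1 0) ?body) s (\<lambda>t s'. I s' \<and> \<not> holds (Less 1 0) s' \<and>
      t + 16 * (n - regs s' 1) \<le> 16 * (n - regs s 1) + 1)"
    by (rule wp_Loop[where I = I and \<Phi> = "\<lambda>s. 16 * (n - regs s 1)"]) (fact body)
  show ?thesis
    unfolding label_def
  proof (rule wp_mono[OF loop], intro conjI)
    fix t s'
    assume *: "I s' \<and> \<not> holds (Less 1 0) s' \<and>
      t + 16 * (n - regs s' 1) \<le> 16 * (n - regs s 1) + 1"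
    then have "regs s' 1 = n" by (auto simp: I_def ordered_def in_place_def)
    then show "\<exists>X.
      (\<forall>k. 0 < k \<longrightarrow> k < n \<longrightarrow> (q k \<in> X) \<noteq> (par (q k) \<in> X) \<longleftrightarrow> q k \<in> S) \<and>
      (\<forall>k<n. arrs s' 2 (q k) = 0 \<longleftrightarrow> q k \<in> X \<inter> (S \<union> par ` S))"
      using * by (intro exI[of _ "{v. arrs s' 8 v \<noteq> 0}"]) (auto simp: I_def)
    show "t \<le> 1 + 16 * n" using * init(3) by auto
  qed
qed

lemma program:
  "wp (search ;; match ;; label) (input_memory adj) (\<lambda>t s. t \<le> 42 * (card V + card E) \<and>
     super_dominating V E (output_set V s) \<and>
     card (output_set V s) = super_domination_number V E)"
proof -
  \<comment> \<open>The last pass is treated first, for arbitrary data and times handed over by the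
    two earlier passes.\<close>
  have "wp label s'' (\<lambda>t'' s. t + (t' + t'') \<le> 42 * (card V + card E) \<and>
     super_dominating V E (output_set V s) \<and>
     card (output_set V s) = super_domination_number V E)"
    if so: "search_order E q par n" "q ` {..<n} = V" and s'': "ordered q par s''" "regs s'' 1 = 0"
    "greedy q par n 0 S" "matched par S s''"
    and t: "t \<le> 4 + 8 * n + 18 * card E" "t' \<le> 3 + 10 * n" for q par S t t' and s'' :: memory
    using label[OF so(1) s''(1,4,2)]
  proof (rule wp_mono)
    fix t'' and s :: memory
    assume *: "(\<exists>X.
    (\<forall>k. 0 < k \<longrightarrow> k < n \<longrightarrow> (q k \<in> X) \<noteq> (par (q k) \<in> X) \<longleftrightarrow> q k \<in> S) \<and>
    (\<forall>k<n. arrs s 2 (q k) = 0 \<longleftrightarrow> q k \<in> X \<inter> (S \<union> par ` S))) \<and> t'' \<le> 1 + 16 * n"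
    then obtain X where
      X: "\<And>k. 0 < k \<Longrightarrow> k < n \<Longrightarrow> (q k \<in> X) \<noteq> (par (q k) \<in> X) \<longleftrightarrow> q k \<in> S"
      and out: "\<And>k. k < n \<Longrightarrow> arrs s 2 (q k) = 0 \<longleftrightarrow> q k \<in> X \<inter> (S \<union> par ` S)" by blast
    let ?M = "(\<lambda>v. {v, par v}) ` S"
    note M = greedy_maximum[OF tree so s''(3)]
    have X': "(q k \<in> X) \<noteq> (par (q k) \<in> X) \<longleftrightarrow> {q k, par (q k)} \<in> ?M" if "0 < k" "k < n" for k
      using X[OF that] M(4)[OF that] by simp
    have D: "output_set V s = V - X \<inter> \<Union>?M"
    proof -
      have "0 < arrs s 2 v \<longleftrightarrow> v \<notin> X \<inter> (S \<union> par ` S)" if "v \<in> V" for v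
        using that out so(2) by (metis imageE lessThan_iff gr0I less_numeral_extra(3))
      then show ?thesis unfolding M(3) by (auto simp: output_set_def)
    qed
    note D = super_dominating_of_labelling[OF sg M(1) search_order_labelling[OF tree so X'] D]
    \<comment> \<open>The three bounds add up to \<open>8 + 34 * m + 18 * e\<close>; since a tree
      has a vertex, the 8 is absorbed into \<open>42 * m\<close>.\<close>
    have "a + (b + c) \<le> 42 * m + 42 * e"
      if "a \<le> 4 + 8 * m + 18 * e" "b \<le> 3 + 10 * m" "c \<le> 1 + 16 * m" "1 \<le> m" for a b c m e :: nat
      using that by linarith
    moreover have "t'' \<le> 1 + 16 * n" using * by blast
    moreover have "card V = n" using V by simp
    ultimately have "t + (t' + t'') \<le> 42 * (card V + card E)" using t n_pos
      by (metis One_nat_def Suc_leI add_mult_distrib2)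
    moreover have "card (output_set V s) = super_domination_number V E"
      using super_domination_number_eqI[OF sg D(1)] D(2) M(2) by simp
    ultimately show "t + (t' + t'') \<le> 42 * (card V + card E) \<and>
       super_dominating V E (output_set V s) \<and>
       card (output_set V s) = super_domination_number V E"
      using D(1) by simp
  qed
  note label = this
  show ?thesis
    unfolding wp_simps
  proof (rule wp_mono[OF search])
    fix t s
    assume s: "in_place s \<and> (\<forall>a\<in>{6, 7, 8}. arrs s a = (\<lambda>_. 0)) \<and>
      search_order E (arrs s 3) (arrs s 4) n \<and> arrs s 3 ` {..<n} = V \<and>
      t \<le> 4 + 8 * n + 18 * card E"
    then have so: "search_order E (arrs s 3) (arrs s 4) n" "arrs s 3 ` {..<n} = V"
      and t: "t \<le> 4 + 8 * n + 18 * card E" by auto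
    have "ordered (arrs s 3) (arrs s 4) s" "arrs s 6 = (\<lambda>_. 0)" "arrs s 7 = (\<lambda>_. 0)"
      using s by (auto simp: ordered_def)
    note match = match[OF so(1) this]
    show "wp match s (\<lambda>t' s'. wp label s' (\<lambda>t'' s. t + (t' + t'') \<le> 42 * (card V + card E) \<and>
        super_dominating V E (output_set V s) \<and>
        card (output_set V s) = super_domination_number V E))"
      by (rule wp_mono[OF match]) (use label[OF so _ _ _ _ t] in blast)
  qed
qed

end

theorem theorem3p1:
  shows "(\<forall>(V :: 'a set) E. tree V E \<longrightarrow>
            int (super_domination_number V E) = int (card V) - int (matching_number E)) \<and>
         (\<exists>p c. \<forall>V E adj. tree V E \<and> adjacency_lists V E adj \<longrightarrow>
            (\<exists>t s. exec p (input_memory adj) t s \<and>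
                   t \<le> c * (card V + card E) \<and>
                   super_dominating V E (output_set V s) \<and>
                   card (output_set V s) = super_domination_number V E))"
proof (intro conjI allI impI)
  fix V :: "'a set" and E
  assume "tree V E"
  then show "int (super_domination_number V E) = int (card V) - int (matching_number E)"
    using tree_super_domination_number by fastforce
next
  show "\<exists>p c. \<forall>V E adj. tree V E \<and> adjacency_lists V E adj \<longrightarrow>
      (\<exists>t s. exec p (input_memory adj) t s \<and> t \<le> c * (card V + card E) \<and>
        super_dominating V E (output_set V s) \<and>
        card (output_set V s) = super_domination_number V E)"
  proof (rule exI[of _ "search ;; match ;; label"], rule exI[of _ 42], intro allI impI)
    fix V E adj
    assume "tree V E \<and> adjacency_lists V E adj"
    then interpret tree_input V E adj by unfold_locales auto
    show "\<exists>t s. exec (search ;; match ;; label) (input_memory adj) t s \<and>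
        t \<le> 42 * (card V + card E) \<and> super_dominating V E (output_set V s) \<and>
        card (output_set V s) = super_domination_number V E"
      using program by (simp add: wp_def)
  qed
qed

end
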